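(* Let $\rho\in[0,1)$, let $n$ be a positive integer, and let $\overline{x}_\rho=(\{i\rho\})_{i\ge1}$. The support of $\nu(\rho,n,z)$, as a function of $z$, equals the range of $x\mapsto S(\rho,n,x)$, $x\in[0,1)$, and is an interval symmetric around $0$ whose length is equal to $nD_n(\overline{x}_\rho)$.
   Context: $\{t\}=t-\lfloor t\rfloor$ denotes the fractional part. For a positive integer $n$ and $x\in[0,1)$, $S(\rho,n,x)=\sum_{i=1}^{n}\left(\{x+i\rho\}-\tfrac12\right)$, and for $z\in\mathbb{R}$ the Birkhoff density is $\nu(\rho,n,z)=\frac1n\,\#\{x\in[0,1): S(\rho,n,x)=z\}$. The support of $\nu(\rho,n,\cdot)$ is the set of $z$ where it is nonzero. For a sequence $\overline{x}=(x_i)_{i\ge1}$ in $[0,1)$ (the model of the circle), the discrepancy of its first $n$ points is $D_n(\overline{x})=\sup_I\left(\frac{A(I,n)}{n}-\ell(I)\right)$, where $A(I,n)=\#\{1\le i\le n: x_i\in I\}$, $\ell(I)$ is the length of $I$, and $I$ ranges over all sets of the form $[a,b)\subseteq[0,1)$ and all complements in $[0,1)$ of such sets.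
   Formalization: The support is a half-open interval (for n = 1 it is [-1/2, 1/2)), so it is not literally symmetric around 0; symmetry is stated for its closure, that is, up to endpoints. *)

theory Defs
  imports "HOL-Analysis.Analysis"
begin

definition birkhoff_sum :: "real \<Rightarrow> nat \<Rightarrow> real \<Rightarrow> real" where
  "birkhoff_sum \<rho> n x = (\<Sum>i=1..n. (frac (x + real i * \<rho>) - 1/2))"

(* For n > 0 the counted set is finite, since birkhoff_sum is piecewise affine in x
   with slope n and finitely many pieces; so card is the true number of points. *)
definition birkhoff_density :: "real \<Rightarrow> nat \<Rightarrow> real \<Rightarrow> real" where
  "birkhoff_density \<rho> n z = real (card {x \<in> {0..<1}. birkhoff_sum \<rho> n x = z}) / real n"

(* The support is the plain nonvanishing set; no closure is taken. *)
definition density_support :: "real \<Rightarrow> nat \<Rightarrow> real set" where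
  "density_support \<rho> n = {z. birkhoff_density \<rho> n z \<noteq> 0}"

definition circle_arcs :: "real set set" where
  "circle_arcs = {I. \<exists>a b. {a..<b} \<subseteq> {0..<1} \<and> (I = {a..<b} \<or> I = {0..<1} - {a..<b})}"

(* Sequences are indexed from 1; the value at index 0 is ignored. *)
definition count_in :: "(nat \<Rightarrow> real) \<Rightarrow> real set \<Rightarrow> nat \<Rightarrow> nat" where
  "count_in x I n = card {i \<in> {1..n}. x i \<in> I}"

definition discrepancy :: "(nat \<Rightarrow> real) \<Rightarrow> nat \<Rightarrow> real" where
  "discrepancy x n = (SUP I\<in>circle_arcs. real (count_in x I n) / real n - measure lborel I)"

definition rotation_seq :: "real \<Rightarrow> nat \<Rightarrow> real" where
  "rotation_seq \<rho> i = frac (real i * \<rho>)"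

end

theory Submission
  imports Defs
begin

text \<open>
  Write \<open>S\<close> for the Birkhoff sum; it is 1-periodic, and \<open>S y - S x\<close> equals \<open>n (y - x)\<close> minus the
  number of jumps in \<open>(x, y]\<close>. Since \<open>S\<close> has no upward jumps, it takes every value between two of
  its values, so its range is an interval; every fibre is finite because \<open>n x - S x\<close> takes only
  finitely many values on \<open>[0, 1)\<close>. The reflection \<open>x \<mapsto> - x - (n + 1) \<rho>\<close> changes the sign of \<open>S\<close>
  away from the jumps. Finally the jumps are the points \<open>- i \<rho>\<close> modulo 1, so that the differences
  \<open>S x - S y\<close> are exactly the numbers \<open>A(I, n) - n \<ell>(I)\<close> for arcs \<open>I\<close>, whose supremum is both the
  length of the range and \<open>n\<close> times the discrepancy.
\<close>

section \<open>Real analysis: intermediate values without continuity, bounded intervals\<close>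

text \<open>The one-sided bound rules out upward jumps, and downward jumps do no harm. The last
  point \<open>x\<close> where \<open>f\<close> is at most \<open>y\<close>, taken as a supremum,
  works: points of \<open>A\<close> to its left give \<open>f x \<le> y\<close>, points outside
  \<open>A\<close> to its right give \<open>y \<le> f x\<close>.\<close>

lemma IVT_one_sided_lipschitz:
  fixes f :: "real \<Rightarrow> real"
  assumes lip: "\<And>s t. s \<le> t \<Longrightarrow> f t - f s \<le> L * (t - s)" and "L > 0"
    and "a \<le> b" "f a \<le> y" "y \<le> f b"
  obtains x where "a \<le> x" "x \<le> b" "f x = y"
proof -
  define A where "A = {x. a \<le> x \<and> x \<le> b \<and> f x \<le> y}"
  define x where "x = Sup A"
  have aA: "a \<in> A" using assms by (auto simp: A_def)
  have bdd: "bdd_above A" by (auto simp: A_def bdd_above_def)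
  have ax: "a \<le> x" unfolding x_def by (rule cSup_upper[OF aA bdd])
  have xb: "x \<le> b" unfolding x_def using aA by (intro cSup_least) (auto simp: A_def)
  have "f x \<le> y + e" if "e > 0" for e
  proof -
    have "x - e / L < x" using that \<open>L > 0\<close> by simp
    then obtain t where t: "t \<in> A" "x - e / L < t"
      unfolding x_def using less_cSup_iff[of A] aA bdd by blast
    have "t \<le> x" unfolding x_def by (rule cSup_upper[OF t(1) bdd])
    then have "f x - f t \<le> L * (x - t)" by (rule lip)
    also have "\<dots> \<le> e" using t(2) \<open>L > 0\<close> by (simp add: field_simps)
    finally show ?thesis using t(1) by (auto simp: A_def)
  qed
  then have le: "f x \<le> y" by (rule field_le_epsilon)
  have ge: "y \<le> f x"
  proof (cases "x = b")
    case True
    then show ?thesis using assms by simp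
  next
    case False
    show ?thesis
    proof (rule field_le_epsilon)
      fix e :: real assume "e > 0"
      \<comment> \<open>A point beyond the supremum but still in the interval, so
        \<open>f t > y\<close>; at distance at most \<open>e / L\<close>, the rise from
        \<open>x\<close> to \<open>t\<close> is at most \<open>e\<close>.\<close>
      define t where "t = min b (x + e / L)"
      have t: "x < t" "t \<le> b" "t - x \<le> e / L"
        using False xb \<open>e > 0\<close> \<open>L > 0\<close> by (auto simp: t_def)
      have "t \<notin> A" using t(1) cSup_upper[OF _ bdd, of t] by (auto simp: x_def)
      then have "y < f t" using t ax by (auto simp: A_def)
      moreover have "f t - f x \<le> L * (t - x)" using t by (intro lip) simp
      moreover have "L * (t - x) \<le> e" using t(3) \<open>L > 0\<close> by (simp add: field_simps)
      ultimately show "y \<le> f x + e" by linarith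
    qed
  qed
  show thesis using that[OF ax xb] le ge by simp
qed

lemma closure_bounded_interval_real:
  fixes R :: "real set"
  assumes "is_interval R" "R \<noteq> {}" "bdd_above R" "bdd_below R"
  shows "closure R = {Inf R..Sup R}"
proof
  show "closure R \<subseteq> {Inf R..Sup R}"
    by (rule closure_minimal) (auto intro!: cInf_lower cSup_upper simp: assms(3,4))
  have "is_interval (closure R)"
    using assms(1) by (simp add: is_interval_connected_1 connected_imp_connected_closure)
  then show "{Inf R..Sup R} \<subseteq> closure R"
    using closure_contains_Inf[OF assms(2,4)] closure_contains_Sup[OF assms(2,3)]
    unfolding is_interval_1 subset_iff atLeastAtMost_iff by blast
qed

text \<open>Which endpoints belong to \<open>R\<close> is irrelevant: \<open>R\<close> lies between
  the open and the closed interval from \<open>Inf R\<close> to \<open>Sup R\<close>.\<close>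

lemma emeasure_bounded_interval_real:
  fixes R :: "real set"
  assumes "is_interval R" "R \<noteq> {}" "bdd_above R" "bdd_below R"
  shows "emeasure lborel R = ennreal (Sup R - Inf R)"
proof (rule antisym)
  have le: "Inf R \<le> Sup R" by (rule cInf_le_cSup[OF assms(2,3,4)])
  have "emeasure lborel R \<le> emeasure lborel {Inf R..Sup R}"
    by (intro emeasure_mono) (auto intro!: cInf_lower cSup_upper simp: assms(3,4))
  then show "emeasure lborel R \<le> ennreal (Sup R - Inf R)" using le by simp
  have "{Inf R<..<Sup R} \<subseteq> R"
  proof
    fix y assume "y \<in> {Inf R<..<Sup R}"
    then obtain u v where "u \<in> R" "u < y" "v \<in> R" "y < v"
      using cInf_less_iff[OF assms(2,4)] less_cSup_iff[OF assms(2,3)] by auto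
    then show "y \<in> R" using assms(1) by (meson is_interval_1 less_imp_le)
  qed
  then have "emeasure lborel {Inf R<..<Sup R} \<le> emeasure lborel R"
    using assms(1) by (intro emeasure_mono) (auto intro: real_interval_borel_measurable)
  then show "ennreal (Sup R - Inf R) \<le> emeasure lborel R" using le by simp
qed

section \<open>Increments, periodicity and boundedness of the Birkhoff sum\<close>

lemma birkhoff_sum_diff:
  "birkhoff_sum \<rho> n y - birkhoff_sum \<rho> n x
    = real n * (y - x)
      - real_of_int ((\<Sum>i=1..n. \<lfloor>y + real i * \<rho>\<rfloor>) - (\<Sum>i=1..n. \<lfloor>x + real i * \<rho>\<rfloor>))"
  by (simp add: birkhoff_sum_def frac_def sum_subtractf sum.distrib algebra_simps)

text \<open>Floors are monotone, so jumps only lower the sum below its linear growth of slope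
  \<open>n\<close>.\<close>

lemma birkhoff_sum_lipschitz:
  assumes "x \<le> y"
  shows "birkhoff_sum \<rho> n y - birkhoff_sum \<rho> n x \<le> real n * (y - x)"
proof -
  have "(\<Sum>i=1..n. \<lfloor>x + real i * \<rho>\<rfloor>) \<le> (\<Sum>i=1..n. \<lfloor>y + real i * \<rho>\<rfloor>)"
    using assms by (intro sum_mono floor_mono) simp
  then show ?thesis unfolding birkhoff_sum_diff by (simp del: of_int_sum)
qed

lemma birkhoff_sum_add_int: "birkhoff_sum \<rho> n (x + of_int k) = birkhoff_sum \<rho> n x"
proof -
  have "frac (x + of_int k + t) = frac (x + t)" for t
    using floor_add_int[of "x + t" k] by (simp add: frac_def algebra_simps)
  then show ?thesis by (simp add: birkhoff_sum_def)
qed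

lemma birkhoff_sum_frac: "birkhoff_sum \<rho> n (frac x) = birkhoff_sum \<rho> n x"
  using birkhoff_sum_add_int[of \<rho> n x "- \<lfloor>x\<rfloor>"] by (simp add: frac_def)

lemma range_birkhoff_sum: "birkhoff_sum \<rho> n ` {0..<1} = range (birkhoff_sum \<rho> n)"
proof
  show "range (birkhoff_sum \<rho> n) \<subseteq> birkhoff_sum \<rho> n ` {0..<1}"
  proof
    fix y assume "y \<in> range (birkhoff_sum \<rho> n)"
    then obtain x where "y = birkhoff_sum \<rho> n (frac x)" by (auto simp: birkhoff_sum_frac)
    then show "y \<in> birkhoff_sum \<rho> n ` {0..<1}" by (auto simp: frac_lt_1)
  qed
qed auto

lemma abs_birkhoff_sum_le: "\<bar>birkhoff_sum \<rho> n x\<bar> \<le> real n / 2"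
proof -
  have "\<bar>birkhoff_sum \<rho> n x\<bar> \<le> (\<Sum>i=1..n. \<bar>frac (x + real i * \<rho>) - 1/2\<bar>)"
    unfolding birkhoff_sum_def by (rule sum_abs)
  also have "\<dots> \<le> (\<Sum>i=1..n. 1/2)"
  proof (rule sum_mono)
    show "\<bar>frac (x + real i * \<rho>) - 1/2\<bar> \<le> 1/2" for i
      using frac_ge_0[of "x + real i * \<rho>"] frac_lt_1[of "x + real i * \<rho>"]
      unfolding abs_le_iff by linarith
  qed
  finally show ?thesis by simp
qed

lemma bdd_range_birkhoff_sum:
  "bdd_above (range (birkhoff_sum \<rho> n))" "bdd_below (range (birkhoff_sum \<rho> n))"
proof -
  have "birkhoff_sum \<rho> n x \<le> real n / 2" "- (real n / 2) \<le> birkhoff_sum \<rho> n x" for x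
    using abs_birkhoff_sum_le[of \<rho> n x] by (simp_all only: abs_le_iff) linarith
  then show "bdd_above (range (birkhoff_sum \<rho> n))" "bdd_below (range (birkhoff_sum \<rho> n))"
    unfolding bdd_above_def bdd_below_def by blast+
qed

section \<open>The range as an interval and as the support of the density\<close>

lemma is_interval_range_birkhoff_sum:
  assumes "n > 0"
  shows "is_interval (range (birkhoff_sum \<rho> n))"
  unfolding is_interval_1
proof (intro ballI allI impI)
  fix u v y assume "u \<in> range (birkhoff_sum \<rho> n)" "v \<in> range (birkhoff_sum \<rho> n)" "u \<le> y \<and> y \<le> v"
  then obtain a b where ab: "birkhoff_sum \<rho> n a \<le> y" "y \<le> birkhoff_sum \<rho> n b" by auto
  \<comment> \<open>Periodicity allows \<open>b\<close> to be moved to the right of \<open>a\<close>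
    without changing its value, as the one-sided intermediate value argument requires.\<close>
  define b' where "b' = b + of_int \<lceil>a - b\<rceil>"
  have "a \<le> b'" unfolding b'_def by linarith
  moreover have "y \<le> birkhoff_sum \<rho> n b'" using ab(2) by (simp add: b'_def birkhoff_sum_add_int)
  moreover have "real n > 0" using assms by simp
  ultimately show "y \<in> range (birkhoff_sum \<rho> n)"
    using IVT_one_sided_lipschitz[OF birkhoff_sum_lipschitz _ _ ab(1)] by (metis rangeI)
qed

text \<open>Needed because \<open>card\<close> is 0 on infinite sets: an infinite fibre would
  wrongly drop out of the support.\<close>

lemma finite_birkhoff_sum_fibre:
  assumes "n > 0"
  shows "finite {x \<in> {0..<1}. birkhoff_sum \<rho> n x = z}"
proof -
  define K where "K x = (\<Sum>i=1..n. \<lfloor>x + real i * \<rho>\<rfloor>)" for x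
  \<comment> \<open>The only possible solution of \<open>birkhoff_sum \<rho> n x = z\<close> with
    floor sum \<open>k\<close>; on the unit interval monotonicity confines \<open>k\<close> to
    \<open>{K 0..K 1}\<close>.\<close>
  define c where "c k = (z - birkhoff_sum \<rho> n 0 + real_of_int (k - K 0)) / real n" for k
  have "x \<in> c ` {K 0..K 1}" if "x \<in> {0..<1}" "birkhoff_sum \<rho> n x = z" for x
  proof
    show "x = c (K x)"
      using birkhoff_sum_diff[of \<rho> n x 0] assms that(2) by (simp add: c_def K_def field_simps)
    show "K x \<in> {K 0..K 1}"
      using that(1) unfolding K_def atLeastAtMost_iff by (intro conjI sum_mono floor_mono) auto
  qed
  then have "{x \<in> {0..<1}. birkhoff_sum \<rho> n x = z} \<subseteq> c ` {K 0..K 1}" by blast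
  then show ?thesis by (rule finite_subset) simp
qed

lemma density_support_eq:
  assumes "n > 0"
  shows "density_support \<rho> n = birkhoff_sum \<rho> n ` {0..<1}"
proof -
  have "birkhoff_density \<rho> n z \<noteq> 0 \<longleftrightarrow> {x \<in> {0..<1}. birkhoff_sum \<rho> n x = z} \<noteq> {}" for z
    using finite_birkhoff_sum_fibre[OF assms, of \<rho> z] assms
    by (simp add: birkhoff_density_def)
  then have "density_support \<rho> n = {z. {x \<in> {0..<1}. birkhoff_sum \<rho> n x = z} \<noteq> {}}"
    unfolding density_support_def by (rule Collect_cong)
  also have "\<dots> = birkhoff_sum \<rho> n ` {0..<1}" by blast
  finally show ?thesis .
qed

section \<open>Reflection and the symmetry of the range\<close>

text \<open>The shift by \<open>(n + 1) \<rho>\<close> is chosen so that reversing the summation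
  order, \<open>i\<close> to \<open>n + 1 - i\<close>, negates each argument.\<close>

lemma birkhoff_sum_reflect:
  "birkhoff_sum \<rho> n (- x - real (Suc n) * \<rho>) = (\<Sum>i=1..n. (frac (- (x + real i * \<rho>)) - 1/2))"
proof -
  let ?y = "- x - real (Suc n) * \<rho>"
  have "birkhoff_sum \<rho> n ?y = (\<Sum>i=1..n. (frac (?y + real (n + 1 - i) * \<rho>) - 1/2))"
    unfolding birkhoff_sum_def by (subst sum.atLeastAtMost_rev) simp
  also have "\<dots> = (\<Sum>i=1..n. (frac (- (x + real i * \<rho>)) - 1/2))"
  proof (rule sum.cong)
    fix i assume "i \<in> {1..n}"
    then have "?y + real (n + 1 - i) * \<rho> = - (x + real i * \<rho>)"
      by (simp add: of_nat_diff algebra_simps)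
    then show "frac (?y + real (n + 1 - i) * \<rho>) - 1/2 = frac (- (x + real i * \<rho>)) - 1/2"
      by (simp only:)
  qed simp
  finally show ?thesis .
qed

text \<open>Termwise, \<open>frac (- t) = 1 - frac t\<close> gives equality unless \<open>t\<close>
  is an integer; there both centred terms are -1/2 and only the inequality survives.\<close>

lemma birkhoff_sum_reflect_le:
  "birkhoff_sum \<rho> n (- x - real (Suc n) * \<rho>) \<le> - birkhoff_sum \<rho> n x"
proof -
  have "frac (- t) - 1/2 \<le> - (frac t - 1/2)" for t :: real
    by (auto simp: frac_neg frac_lt_1 less_imp_le)
  then show ?thesis
    unfolding birkhoff_sum_reflect by (simp only: birkhoff_sum_def flip: sum_negf) (rule sum_mono)
qed

text \<open>Just to the right of \<open>x\<close> no argument is an integer, so the reflection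
  negates the sum exactly, and the sum has grown by \<open>n e\<close>.\<close>

lemma birkhoff_sum_reflect_right:
  "\<exists>d>0. \<forall>e. 0 < e \<and> e < d \<longrightarrow>
    birkhoff_sum \<rho> n (- (x + e) - real (Suc n) * \<rho>) = - birkhoff_sum \<rho> n x - real n * e"
proof -
  \<comment> \<open>Distance from \<open>x\<close> to the next jump, capped at 1; the extra element
    keeps the set nonempty when \<open>n = 0\<close>.\<close>
  define d where "d = Min (insert 1 ((\<lambda>i. 1 - frac (x + real i * \<rho>)) ` {1..n}))"
  have "d > 0" by (auto simp: d_def frac_lt_1)
  moreover have "birkhoff_sum \<rho> n (- (x + e) - real (Suc n) * \<rho>)
      = - birkhoff_sum \<rho> n x - real n * e" if e: "0 < e" "e < d" for e
  proof -
    have fr: "frac (- (x + e + real i * \<rho>)) = 1 - frac (x + real i * \<rho>) - e" if i: "i \<in> {1..n}" for i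
    proof -
      have "d \<le> 1 - frac (x + real i * \<rho>)" unfolding d_def using i by (intro Min_le) auto
      then have lt: "frac (x + real i * \<rho>) + e < 1" using e by linarith
      have ge: "0 \<le> frac (x + real i * \<rho>)" by simp
      have "- (x + e + real i * \<rho>) - (1 - frac (x + real i * \<rho>) - e) \<in> \<int>"
        by (simp add: frac_def)
      moreover have "0 \<le> 1 - frac (x + real i * \<rho>) - e" "1 - frac (x + real i * \<rho>) - e < 1"
        using lt ge e(1) by linarith+
      ultimately show ?thesis unfolding frac_unique_iff by blast
    qed
    have "birkhoff_sum \<rho> n (- (x + e) - real (Suc n) * \<rho>)
        = (\<Sum>i=1..n. - (frac (x + real i * \<rho>) - 1/2) - e)"
      unfolding birkhoff_sum_reflect by (rule sum.cong[OF refl]) (simp only: fr)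
    also have "\<dots> = - birkhoff_sum \<rho> n x - real n * e"
      by (simp only: birkhoff_sum_def sum_subtractf sum_negf) simp
    finally show ?thesis .
  qed
  ultimately show ?thesis by blast
qed

lemma Sup_range_birkhoff_sum:
  "Sup (range (birkhoff_sum \<rho> n)) = - Inf (range (birkhoff_sum \<rho> n))"
proof (rule antisym)
  let ?R = "range (birkhoff_sum \<rho> n)"
  show "Sup ?R \<le> - Inf ?R"
  proof (rule cSup_least)
    fix u assume "u \<in> ?R"
    then obtain x where u: "u = birkhoff_sum \<rho> n x" by blast
    have "Inf ?R \<le> birkhoff_sum \<rho> n (- x - real (Suc n) * \<rho>)"
      by (rule cInf_lower[OF rangeI bdd_range_birkhoff_sum(2)])
    also have "\<dots> \<le> - u" unfolding u by (rule birkhoff_sum_reflect_le)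
    finally show "u \<le> - Inf ?R" by simp
  qed simp
  have "- Sup ?R \<le> Inf ?R"
  proof (rule cInf_greatest)
    fix u assume "u \<in> ?R"
    then obtain x where u: "u = birkhoff_sum \<rho> n x" by blast
    obtain d where d: "d > 0" "\<And>e. 0 < e \<Longrightarrow> e < d \<Longrightarrow>
        birkhoff_sum \<rho> n (- (x + e) - real (Suc n) * \<rho>) = - u - real n * e"
      using birkhoff_sum_reflect_right[of \<rho> n x] unfolding u by blast
    show "- Sup ?R \<le> u"
    proof (rule field_le_epsilon)
      fix \<epsilon> :: real assume "\<epsilon> > 0"
      \<comment> \<open>Half of \<open>d\<close> stays strictly before the next jump; the
        denominator \<open>n + 1\<close> is positive even for \<open>n = 0\<close> and gives
        \<open>n e \<le> \<epsilon>\<close>.\<close>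
      define e where "e = min (d / 2) (\<epsilon> / (real n + 1))"
      have e: "0 < e" "e < d" "e \<le> \<epsilon> / (real n + 1)" using d \<open>\<epsilon> > 0\<close> by (auto simp: e_def)
      have "- u - real n * e \<le> Sup ?R"
        unfolding d(2)[OF e(1,2), symmetric] by (rule cSup_upper[OF rangeI bdd_range_birkhoff_sum(1)])
      moreover have "real n * e \<le> \<epsilon>" using e by (simp add: field_simps)
      ultimately show "- Sup ?R \<le> u + \<epsilon>" by linarith
    qed
  qed simp
  then show "- Inf ?R \<le> Sup ?R" by simp
qed

section \<open>Arc counts as increments of the Birkhoff sum, and the discrepancy\<close>

lemma floor_diff_eq_indicator_frac:
  fixes t a b :: real
  assumes "0 \<le> a" "a \<le> b" "b \<le> 1"
  shows "\<lfloor>t - a\<rfloor> - \<lfloor>t - b\<rfloor> = (if frac t \<in> {a..<b} then 1 else 0)"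
proof -
  have "\<lfloor>t - c\<rfloor> = (if c \<le> frac t then \<lfloor>t\<rfloor> else \<lfloor>t\<rfloor> - 1)" if "0 \<le> c" "c \<le> 1" for c
    unfolding frac_def using that by (split if_split) linarith
  then show ?thesis using assms by auto
qed

text \<open>Membership of \<open>frac (i \<rho>)\<close> in the arc is a difference of floors at
  \<open>- a\<close> and \<open>- b\<close>; summed over \<open>i\<close>, these are the jumps in
  the increment formula.\<close>

lemma count_in_rotation_seq:
  assumes "0 \<le> a" "a \<le> b" "b \<le> 1"
  shows "real (count_in (rotation_seq \<rho>) {a..<b} n) - real n * (b - a)
    = birkhoff_sum \<rho> n (- b) - birkhoff_sum \<rho> n (- a)"
proof -
  have "int (count_in (rotation_seq \<rho>) {a..<b} n)
      = (\<Sum>i=1..n. if frac (real i * \<rho>) \<in> {a..<b} then 1 else 0)"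
    by (simp add: count_in_def rotation_seq_def sum.If_cases Int_def)
  also have "\<dots> = (\<Sum>i=1..n. \<lfloor>- a + real i * \<rho>\<rfloor> - \<lfloor>- b + real i * \<rho>\<rfloor>)"
    using floor_diff_eq_indicator_frac[OF assms] by (intro sum.cong) (simp_all add: algebra_simps)
  finally have "real (count_in (rotation_seq \<rho>) {a..<b} n)
      = real_of_int ((\<Sum>i=1..n. \<lfloor>- a + real i * \<rho>\<rfloor>) - (\<Sum>i=1..n. \<lfloor>- b + real i * \<rho>\<rfloor>))"
    by (metis of_int_of_nat_eq sum_subtractf)
  then show ?thesis
    unfolding birkhoff_sum_diff by (simp add: algebra_simps)
qed

lemma count_in_rotation_seq_compl:
  assumes "I \<subseteq> {0..<1}"
  shows "real (count_in (rotation_seq \<rho>) ({0..<1} - I) n)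
    = real n - real (count_in (rotation_seq \<rho>) I n)"
proof -
  let ?J = "{i \<in> {1..n}. rotation_seq \<rho> i \<in> I}"
  have "{i \<in> {1..n}. rotation_seq \<rho> i \<in> {0..<1} - I} = {1..n} - ?J"
    by (auto simp: rotation_seq_def frac_lt_1)
  moreover have "card ({1..n} - ?J) = n - card ?J"
    by (subst card_Diff_subset) auto
  moreover have "card ?J \<le> n" using card_mono[of "{1..n}" ?J] by fastforce
  ultimately show ?thesis by (simp add: count_in_def of_nat_diff)
qed

text \<open>Passing to the complement turns the count \<open>A\<close> into \<open>n - A\<close> and
  the length into 1 minus itself, hence reverses the sign.\<close>

lemma arc_discrepancy:
  assumes "0 \<le> a" "a \<le> b" "b \<le> 1" and "n > 0"
  shows "real (count_in (rotation_seq \<rho>) {a..<b} n) / real n - measure lborel {a..<b}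
      = (birkhoff_sum \<rho> n (- b) - birkhoff_sum \<rho> n (- a)) / real n" (is ?A)
    and "real (count_in (rotation_seq \<rho>) ({0..<1} - {a..<b}) n) / real n
        - measure lborel ({0..<1} - {a..<b})
      = (birkhoff_sum \<rho> n (- a) - birkhoff_sum \<rho> n (- b)) / real n" (is ?B)
proof -
  have sub: "{a..<b} \<subseteq> {0..<1}" using assms by auto
  have c: "real (count_in (rotation_seq \<rho>) {a..<b} n) - real n * (b - a)
    = birkhoff_sum \<rho> n (- b) - birkhoff_sum \<rho> n (- a)"
    by (rule count_in_rotation_seq[OF assms(1-3)])
  show ?A unfolding c[symmetric] using assms by (simp add: field_simps)
  have "measure lborel ({0..<1::real} - {a..<b}) = 1 - (b - a)"
    using assms sub by (subst measure_Diff) auto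
  moreover have "birkhoff_sum \<rho> n (- a) - birkhoff_sum \<rho> n (- b)
    = - (real (count_in (rotation_seq \<rho>) {a..<b} n) - real n * (b - a))" unfolding c by simp
  ultimately show ?B
    using assms(4)
    by (simp add: count_in_rotation_seq_compl[OF sub] diff_divide_distrib right_diff_distrib)
qed

lemma image_arc_discrepancy:
  assumes "n > 0"
  shows "(\<lambda>I. real (count_in (rotation_seq \<rho>) I n) / real n - measure lborel I) ` circle_arcs
    = {(u - v) / real n | u v. u \<in> range (birkhoff_sum \<rho> n) \<and> v \<in> range (birkhoff_sum \<rho> n)}"
    (is "?g ` _ = ?D")
proof (intro equalityI subsetI)
  fix r assume "r \<in> ?g ` circle_arcs"
  then obtain I where I: "I \<in> circle_arcs" and r: "r = ?g I" by blast
  then obtain a b where "{a..<b} \<subseteq> {0..<1}" "I = {a..<b} \<or> I = {0..<1} - {a..<b}"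
    unfolding circle_arcs_def by blast
  \<comment> \<open>An empty \<open>{a..<b}\<close> says nothing about its endpoints, so they are
    replaced by 0.\<close>
  then obtain a b where ab: "0 \<le> a" "a \<le> b" "b \<le> 1" "I = {a..<b} \<or> I = {0..<1} - {a..<b}"
  proof (cases "a < b")
    case True
    with \<open>{a..<b} \<subseteq> {0..<1}\<close> have "0 \<le> a" "b \<le> 1" by auto
    then show ?thesis using that[of a b] True \<open>I = {a..<b} \<or> I = {0..<1} - {a..<b}\<close> by simp
  next
    case False
    then show ?thesis using that[of 0 0] \<open>I = {a..<b} \<or> I = {0..<1} - {a..<b}\<close> by simp
  qed
  then have "r = (birkhoff_sum \<rho> n (- b) - birkhoff_sum \<rho> n (- a)) / real n
      \<or> r = (birkhoff_sum \<rho> n (- a) - birkhoff_sum \<rho> n (- b)) / real n"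
    using arc_discrepancy[OF ab(1-3) assms, of \<rho>] unfolding r by metis
  then show "r \<in> ?D" by blast
next
  fix r assume "r \<in> ?D"
  then obtain x y where xy: "x \<in> {0..<1}" "y \<in> {0..<1}"
    and r: "r = (birkhoff_sum \<rho> n x - birkhoff_sum \<rho> n y) / real n"
    unfolding range_birkhoff_sum[symmetric] by blast
  \<comment> \<open>By periodicity \<open>- a\<close> and \<open>- b\<close> have the values of
    \<open>y\<close> and \<open>x\<close>. The order of \<open>a\<close> and \<open>b\<close>
    decides whether an arc or a complement realises the difference.\<close>
  define a b where "a = 1 - y" and "b = 1 - x"
  have ab: "0 \<le> a" "a \<le> 1" "0 \<le> b" "b \<le> 1" using xy by (auto simp: a_def b_def)
  have "birkhoff_sum \<rho> n (- a) = birkhoff_sum \<rho> n y" "birkhoff_sum \<rho> n (- b) = birkhoff_sum \<rho> n x"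
    using birkhoff_sum_add_int[of \<rho> n _ "-1"] by (simp_all add: a_def b_def)
  then have r: "r = (birkhoff_sum \<rho> n (- b) - birkhoff_sum \<rho> n (- a)) / real n" using r by simp
  show "r \<in> ?g ` circle_arcs"
  proof (cases "a \<le> b")
    case True
    have "r = ?g {a..<b}" unfolding r by (rule arc_discrepancy(1)[symmetric]) (use ab True assms in auto)
    moreover have "{a..<b} \<in> circle_arcs" unfolding circle_arcs_def using ab by force
    ultimately show ?thesis by (rule image_eqI)
  next
    case False
    have "r = ?g ({0..<1} - {b..<a})"
      unfolding r by (rule arc_discrepancy(2)[symmetric]) (use ab False assms in auto)
    moreover have "{0..<1} - {b..<a} \<in> circle_arcs" unfolding circle_arcs_def using ab by force
    ultimately show ?thesis by (rule image_eqI)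
  qed
qed

lemma discrepancy_rotation_seq:
  assumes "n > 0"
  shows "real n * discrepancy (rotation_seq \<rho>) n
    = Sup (range (birkhoff_sum \<rho> n)) - Inf (range (birkhoff_sum \<rho> n))"
proof -
  let ?R = "range (birkhoff_sum \<rho> n)"
  let ?D = "{(u - v) / real n | u v. u \<in> ?R \<and> v \<in> ?R}"
  have "Sup ?D = (Sup ?R - Inf ?R) / real n"
  proof (rule cSup_eq_non_empty)
    fix r assume "r \<in> ?D"
    then obtain u v where "u \<in> ?R" "v \<in> ?R" and r: "r = (u - v) / real n" by blast
    then have "u \<le> Sup ?R" "Inf ?R \<le> v"
      by (auto intro: cSup_upper cInf_lower bdd_range_birkhoff_sum)
    then show "r \<le> (Sup ?R - Inf ?R) / real n"
      unfolding r by (intro divide_right_mono) linarith+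
  next
    fix s assume s: "\<And>r. r \<in> ?D \<Longrightarrow> r \<le> s"
    have *: "u - v \<le> real n * s" if "u \<in> ?R" "v \<in> ?R" for u v
      using s[of "(u - v) / real n"] that assms by (force simp: field_simps)
    \<comment> \<open>The two extrema are separated: first the supremum over \<open>u\<close> for
      fixed \<open>v\<close>, then the infimum over \<open>v\<close>.\<close>
    have "Sup ?R \<le> v + real n * s" if "v \<in> ?R" for v
      using *[OF _ that] by (intro cSup_least) (auto simp: algebra_simps)
    then have "Sup ?R - real n * s \<le> Inf ?R"
      by (intro cInf_greatest) (auto simp: algebra_simps)
    then show "(Sup ?R - Inf ?R) / real n \<le> s" using assms by (simp add: field_simps)
  qed blast
  then show ?thesis
    unfolding discrepancy_def image_arc_discrepancy[OF assms] using assms by simp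
qed

(* The support is half-open (for n = 1 it is [-1/2, 1/2)), so its symmetry around 0
   can only hold up to endpoints; this is expressed on the closure. *)
theorem corollary3p2:
  fixes \<rho> :: real and n :: nat
  assumes "\<rho> \<in> {0..<1}" and "n > 0"
  shows "density_support \<rho> n = birkhoff_sum \<rho> n ` {0..<1}
    \<and> is_interval (density_support \<rho> n)
    \<and> uminus ` closure (density_support \<rho> n) = closure (density_support \<rho> n)
    \<and> emeasure lborel (density_support \<rho> n) = ennreal (real n * discrepancy (rotation_seq \<rho>) n)"
proof -
  have supp: "density_support \<rho> n = range (birkhoff_sum \<rho> n)"
    using density_support_eq[OF assms(2)] range_birkhoff_sum by simp
  note R = is_interval_range_birkhoff_sum[OF assms(2), of \<rho>]
    bdd_range_birkhoff_sum[of \<rho> n]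
  have ne: "range (birkhoff_sum \<rho> n) \<noteq> {}" by simp
  \<comment> \<open>Closing the interval discards the question of endpoints, leaving
    \<open>{m..- m}\<close>, which negation preserves.\<close>
  have cl: "closure (density_support \<rho> n)
      = {Inf (range (birkhoff_sum \<rho> n))..- Inf (range (birkhoff_sum \<rho> n))}"
    unfolding supp closure_bounded_interval_real[OF R(1) ne R(2,3)] Sup_range_birkhoff_sum ..
  have "uminus ` closure (density_support \<rho> n) = closure (density_support \<rho> n)"
    unfolding cl by simp
  moreover have "emeasure lborel (density_support \<rho> n)
      = ennreal (real n * discrepancy (rotation_seq \<rho>) n)"
    unfolding supp emeasure_bounded_interval_real[OF R(1) ne R(2,3)]
      discrepancy_rotation_seq[OF assms(2)] ..
  ultimately show ?thesis
    using density_support_eq[OF assms(2)] R(1) supp by simp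
qed

end
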